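(* Let $G_1, G_2$ be arbitrary simple graphs on $n_1, n_2 \geq 1$ vertices, respectively, and let $\lambda_1(G_1) \geq \dots \geq \lambda_{n_1}(G_1)$ be the eigenvalues of the adjacency matrix $A(G_1)$. Then $$\phi(A(G_1 \star G_2); x) = (\phi(A(G_2); x))^{n_1} \cdot \prod_{i=1}^{n_1} \left(x - \lambda_i(G_1) - \Gamma_{A(G_2)}(x)\,\lambda_i(G_1)^2\right).$$
   Context: All graphs are finite, undirected and simple. For a square matrix $M$ of order $n$, $\phi(M;x)=\det(xI_n-M)$ is its characteristic polynomial, and its $M$-coronal is the rational function $\Gamma_M(x)=\mathbf{1}_n^T(xI_n-M)^{-1}\mathbf{1}_n$, where $\mathbf{1}_n$ is the all-ones column vector of length $n$. $A(G)$ denotes the adjacency matrix of a graph $G$. The neighbourhood corona $G_1\star G_2$ of graphs $G_1$ (with vertices $v_1,\dots,v_{n_1}$) and $G_2$ (on $n_2$ vertices) is the graph obtained by taking one copy of $G_1$ and $n_1$ copies of $G_2$, all vertex-disjoint, and joining every neighbour (in $G_1$) of the $i$th vertex $v_i$ of $G_1$ to every vertex of the $i$th copy of $G_2$ by a new edge, for each $i=1,\dots,n_1$. The identity is an identity of rational functions in $x$. *)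

theory Defs
  imports
    "Graph_Theory.Pair_Digraph"
    "Jordan_Normal_Form.Char_Poly"
    "Jordan_Normal_Form.Gauss_Jordan_Elimination"
    "HOL-Computational_Algebra.Polynomial_Factorial"
begin

text \<open>
  Finite simple graphs are \<^locale>\<open>pair_graph\<close>s: finite, loop-free and symmetric, so that an
  undirected edge \<open>{u, v}\<close> is represented by the two arcs \<open>(u, v)\<close> and \<open>(v, u)\<close>.

  The list \<open>vs\<close> enumerates the vertices and fixes the order of the rows and columns.
\<close>

definition adj_matrix :: "'a list \<Rightarrow> 'a pair_pre_digraph \<Rightarrow> real mat" where
  "adj_matrix vs G = mat (length vs) (length vs)
     (\<lambda>(i, j). if (vs ! i, vs ! j) \<in> parcs G then 1 else 0)"

text \<open>
  \<open>Inl v\<close> is the vertex \<open>v\<close> of \<open>G\<close>; \<open>Inr (v, u)\<close> is the vertex \<open>u\<close> in the copy of \<open>H\<close> that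
  belongs to the vertex \<open>v\<close> of \<open>G\<close>.
\<close>

definition nbhd_corona ::
  "'a pair_pre_digraph \<Rightarrow> 'b pair_pre_digraph \<Rightarrow> ('a + 'a \<times> 'b) pair_pre_digraph" where
  "nbhd_corona G H =
    \<lparr> pverts = Inl ` pverts G \<union> Inr ` (pverts G \<times> pverts H),
      parcs = {(Inl v, Inl w) | v w. (v, w) \<in> parcs G}
        \<union> {(Inr (v, u), Inr (v, u')) | v u u'. v \<in> pverts G \<and> (u, u') \<in> parcs H}
        \<union> {(Inl w, Inr (v, u)) | v w u. (v, w) \<in> parcs G \<and> u \<in> pverts H}
        \<union> {(Inr (v, u), Inl w) | v w u. (v, w) \<in> parcs G \<and> u \<in> pverts H} \<rparr>"

lemma pair_graph_nbhd_corona: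
  assumes "pair_graph G" and "pair_graph H"
  shows "pair_graph (nbhd_corona G H)"
proof -
  interpret G: pair_graph G by fact
  interpret H: pair_graph H by fact
  let ?K = "nbhd_corona G H"
  have V: "finite (pverts ?K)"
    by (simp add: nbhd_corona_def G.pair_finite_verts H.pair_finite_verts)
  have sub: "parcs ?K \<subseteq> pverts ?K \<times> pverts ?K"
    by (auto simp: nbhd_corona_def dest: G.in_arcsD1 G.in_arcsD2 H.in_arcsD1 H.in_arcsD2)
  have G_sym: "(v, u) \<in> parcs G" if "(u, v) \<in> parcs G" for u v
    using G.pair_sym_arcs that by (auto simp: symmetric_def dest: symD)
  have H_sym: "(v, u) \<in> parcs H" if "(u, v) \<in> parcs H" for u v
    using H.pair_sym_arcs that by (auto simp: symmetric_def dest: symD)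
  show ?thesis
  proof
    show "finite (parcs ?K)"
      using V sub by (meson finite_SigmaI finite_subset)
    show "symmetric ?K"
      unfolding symmetric_def with_proj_simps
      by (rule symI) (auto simp: nbhd_corona_def intro: G_sym H_sym)
    show "fst e \<noteq> snd e" if "e \<in> parcs ?K" for e
      using that by (auto simp: nbhd_corona_def dest: G.no_loops' H.no_loops')
  qed (use V sub in auto)
qed

text \<open>
  Rational functions are elements of \<^typ>\<open>real poly fract\<close>, the fraction field of the polynomial
  ring, and \<^const>\<open>char_poly_matrix\<close> is the polynomial matrix \<open>x I - M\<close>. Its determinant is monic,
  so the inverse over the fraction field always exists.
\<close>

definition coronal :: "real mat \<Rightarrow> real poly fract" where
  "coronal M =
    (let one = vec (dim_row M) (\<lambda>_. 1)
     in one \<bullet> (the (mat_inverse (map_mat to_fract (char_poly_matrix M))) *\<^sub>v one))"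

text \<open>
  The \<open>i\<close>-th largest real eigenvalue, counted with algebraic multiplicity, for \<open>i = 1, 2, \<dots>\<close>.
  A symmetric matrix of order \<open>n\<close> has \<open>n\<close> of them.
\<close>

definition nth_eigenvalue :: "real mat \<Rightarrow> nat \<Rightarrow> real" where
  "nth_eigenvalue M i = rev (sorted_list_of_multiset (proots (char_poly M))) ! (i - 1)"

lemma eigenvalue_iff_proots:
  fixes M :: "real mat"
  assumes "M \<in> carrier_mat n n"
  shows "eigenvalue M k \<longleftrightarrow> k \<in># proots (char_poly M)"
proof -
  have "char_poly M \<noteq> 0"
    using degree_monic_char_poly[OF assms] by auto
  then show ?thesis
    using eigenvalue_root_char_poly[OF assms] by simp
qed

end

theory Submission
  imports Defs "Jordan_Normal_Form.Schur_Decomposition"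
begin

text \<open>
  List the vertices of the corona as those of \<open>G\<^sub>1\<close> followed by the copies of \<open>G\<^sub>2\<close>. With \<open>J\<close> the
  all-ones row of length \<open>n\<^sub>2\<close>, the adjacency matrix then has the blocks \<open>A\<^sub>1\<close>, \<open>A\<^sub>1 \<otimes> J\<close>,
  \<open>A\<^sub>1 \<otimes> J\<^sup>T\<close> and \<open>I \<otimes> A\<^sub>2\<close>. Over the field of rational functions \<open>I \<otimes> (x I - A\<^sub>2)\<close> is
  invertible, and by the mixed-product rule its Schur complement in the characteristic matrix is
  \<open>x I - A\<^sub>1 - A\<^sub>1\<^sup>2 \<otimes> (J (x I - A\<^sub>2)\<^sup>-\<^sup>1 J\<^sup>T) = x I - A\<^sub>1 - \<Gamma> A\<^sub>1\<^sup>2\<close>. Since \<open>A\<^sub>1\<close> is real symmetric, it is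
  triangularisable over the reals, so the determinant of this quadratic expression is the product of
  \<open>x - \<lambda> - \<Gamma> \<lambda>\<^sup>2\<close> over the eigenvalues \<open>\<lambda>\<close>.
\<close>

section \<open>Kronecker products\<close>

text \<open>An index encodes a pair by quotient and remainder. This is the order in which
  \<open>List.product\<close> lists pairs, so that the vertices of the copies of \<open>H\<close>
  match the rows and columns.\<close>

definition kron :: "'a :: semiring_1 mat \<Rightarrow> 'a mat \<Rightarrow> 'a mat" where
  "kron A B = mat (dim_row A * dim_row B) (dim_col A * dim_col B)
     (\<lambda>(i, j). A $$ (i div dim_row B, j div dim_col B) * B $$ (i mod dim_row B, j mod dim_col B))"

lemma dim_kron [simp]:
  "dim_row (kron A B) = dim_row A * dim_row B" "dim_col (kron A B) = dim_col A * dim_col B"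
  by (auto simp: kron_def)

lemma kron_carrier [simp]:
  "A \<in> carrier_mat a b \<Longrightarrow> B \<in> carrier_mat c d \<Longrightarrow> kron A B \<in> carrier_mat (a * c) (b * d)"
  by (auto simp: kron_def)

lemma div_mod_less_mult:
  fixes i :: nat
  assumes "i < n * m"
  shows "i div m < n" "i mod m < m"
proof -
  have "0 < m" using assms by (cases m) auto
  then show "i div m < n" "i mod m < m"
    using assms by (auto simp: less_mult_imp_div_less)
qed

lemma kron_index:
  assumes "A \<in> carrier_mat a b" "B \<in> carrier_mat c d" "i < a * c" "j < b * d"
  shows "kron A B $$ (i, j) = A $$ (i div c, j div d) * B $$ (i mod c, j mod d)"
  using assms by (auto simp: kron_def)

lemma sum_div_mod:
  fixes f :: "nat \<Rightarrow> nat \<Rightarrow> 'a :: comm_monoid_add"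
  shows "(\<Sum>k<n * m. f (k div m) (k mod m)) = (\<Sum>a<n. \<Sum>b<m. f a b)"
proof -
  have "(\<Sum>k<n * m. f (k div m) (k mod m))
      = (\<Sum>a<n. \<Sum>k = a * m..<a * m + m. f (k div m) (k mod m))"
    by (rule sum.nat_group[symmetric])
  also have "\<dots> = (\<Sum>a<n. \<Sum>b<m. f a b)"
  proof (rule sum.cong[OF refl])
    fix a
    have "(\<Sum>k = a * m..<a * m + m. f (k div m) (k mod m))
        = (\<Sum>b<m. f ((a * m + b) div m) ((a * m + b) mod m))"
      by (rule sum.reindex_bij_witness[of _ "\<lambda>b. a * m + b" "\<lambda>k. k - a * m"]) auto
    also have "\<dots> = (\<Sum>b<m. f a b)"
      by (rule sum.cong) auto
    finally show "(\<Sum>k = a * m..<a * m + m. f (k div m) (k mod m)) = (\<Sum>b<m. f a b)" .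
  qed
  finally show ?thesis .
qed

lemma index_mult_mat_sum:
  assumes "A \<in> carrier_mat a b" "B \<in> carrier_mat b c" "i < a" "j < c"
  shows "(A * B) $$ (i, j) = (\<Sum>k<b. A $$ (i, k) * B $$ (k, j))"
  using assms by (auto simp: scalar_prod_def atLeast0LessThan)

text \<open>The mixed-product rule: splitting the inner index into quotient and remainder turns the
  entry into a double sum, which factors into an entry of \<open>A * C\<close> and one of
  \<open>B * D\<close>.\<close>

lemma kron_mult:
  fixes A :: "'a :: comm_semiring_1 mat"
  assumes A: "A \<in> carrier_mat a b" and B: "B \<in> carrier_mat a' b'"
    and C: "C \<in> carrier_mat b c" and D: "D \<in> carrier_mat b' c'"
  shows "kron A B * kron C D = kron (A * C) (B * D)"
proof (rule eq_matI)
  have AC: "A * C \<in> carrier_mat a c" and BD: "B * D \<in> carrier_mat a' c'"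
    using assms by auto
  note K = kron_carrier[OF AC BD] kron_carrier[OF A B] kron_carrier[OF C D]
  then show "dim_row (kron A B * kron C D) = dim_row (kron (A * C) (B * D))"
    "dim_col (kron A B * kron C D) = dim_col (kron (A * C) (B * D))"
    by auto
  fix i j
  assume "i < dim_row (kron (A * C) (B * D))" "j < dim_col (kron (A * C) (B * D))"
  with K have i: "i < a * a'" and j: "j < c * c'" by auto
  note i' = div_mod_less_mult[OF i] and j' = div_mod_less_mult[OF j]
  have "(kron A B * kron C D) $$ (i, j) = (\<Sum>k<b * b'. kron A B $$ (i, k) * kron C D $$ (k, j))"
    by (rule index_mult_mat_sum[OF K(2,3) i j])
  also have "\<dots> = (\<Sum>k<b * b'. (A $$ (i div a', k div b') * B $$ (i mod a', k mod b')) *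
      (C $$ (k div b', j div c') * D $$ (k mod b', j mod c')))"
    by (intro sum.cong refl, simp add: kron_index[OF A B i] kron_index[OF C D _ j])
  also have "\<dots> = (\<Sum>k<b. \<Sum>l<b'. (A $$ (i div a', k) * B $$ (i mod a', l)) *
      (C $$ (k, j div c') * D $$ (l, j mod c')))"
    by (rule sum_div_mod)
  also have "\<dots> = (\<Sum>k<b. A $$ (i div a', k) * C $$ (k, j div c')) *
      (\<Sum>l<b'. B $$ (i mod a', l) * D $$ (l, j mod c'))"
    by (simp add: sum_product mult_ac)
  also have "\<dots> = kron (A * C) (B * D) $$ (i, j)"
    by (simp only: kron_index[OF AC BD i j] index_mult_mat_sum[OF A C i'(1) j'(1)]
        index_mult_mat_sum[OF B D i'(2) j'(2)])
  finally show "(kron A B * kron C D) $$ (i, j) = kron (A * C) (B * D) $$ (i, j)" .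
qed

lemma kron_one_one: "kron (1\<^sub>m n) (1\<^sub>m m) = 1\<^sub>m (n * m)"
proof (rule eq_matI)
  fix i j :: nat
  assume "i < dim_row (1\<^sub>m (n * m))" "j < dim_col (1\<^sub>m (n * m))"
  then have i: "i < n * m" and j: "j < n * m" by auto
  have "i = j \<longleftrightarrow> i div m = j div m \<and> i mod m = j mod m"
    by (metis div_mult_mod_eq)
  then show "kron (1\<^sub>m n) (1\<^sub>m m) $$ (i, j) = 1\<^sub>m (n * m) $$ (i, j)"
    using i j by (auto simp: kron_index[where a=n and b=n and c=m and d=m] div_mod_less_mult)
qed (auto simp: kron_def)

text \<open>Splitting off the last diagonal block provides the induction step for
  \<open>det_kron_one\<close>.\<close>

lemma kron_one_Suc:
  assumes C: "C \<in> carrier_mat m m"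
  shows "kron (1\<^sub>m (Suc n)) C = four_block_mat (kron (1\<^sub>m n) C) (0\<^sub>m (n * m) m) (0\<^sub>m m (n * m)) C"
proof (rule eq_matI)
  fix i j
  assume "i < dim_row (four_block_mat (kron (1\<^sub>m n) C) (0\<^sub>m (n * m) m) (0\<^sub>m m (n * m)) C)"
    and "j < dim_col (four_block_mat (kron (1\<^sub>m n) C) (0\<^sub>m (n * m) m) (0\<^sub>m m (n * m)) C)"
  then have i: "i < Suc n * m" and j: "j < Suc n * m" using C by (auto simp: kron_def)
  \<comment> \<open>An index past the first \<open>n\<close> blocks lies in the last one, hence has
    quotient exactly \<open>n\<close>.\<close>
  have last: "k div m = n \<and> k mod m = k - n * m" if "k < Suc n * m" "\<not> k < n * m" for k
  proof -
    have "k = (k - n * m) + n * m" "k - n * m < m" using that by auto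
    then show ?thesis
      by (metis add.right_neutral add_left_cancel div_less div_mult_self3 mod_less
          mod_mult_self1 add.commute not_less_zero)
  qed
  have first: "k div m < n \<and> k div m \<noteq> n \<and> n \<noteq> k div m" if "k < n * m" for k
    using div_mod_less_mult(1)[OF that] by simp
  show "kron (1\<^sub>m (Suc n)) C $$ (i, j)
      = four_block_mat (kron (1\<^sub>m n) C) (0\<^sub>m (n * m) m) (0\<^sub>m m (n * m)) C $$ (i, j)"
    using C i j first[of i] first[of j] last[of i] last[of j]
    by (cases "i < n * m"; cases "j < n * m")
      (simp_all add: kron_index[OF one_carrier_mat C] div_mod_less_mult)
qed (use C in \<open>auto simp: kron_def\<close>)

lemma kron_minus:
  fixes A :: "'a :: ring_1 mat"
  assumes "B \<in> carrier_mat c d" "C \<in> carrier_mat c d"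
  shows "kron A (B - C) = kron A B - kron A C"
  using assms by (intro eq_matI) (auto simp: kron_def div_mod_less_mult right_diff_distrib)

lemma kron_smult:
  fixes A :: "'a :: comm_semiring_1 mat"
  shows "kron A (x \<cdot>\<^sub>m B) = x \<cdot>\<^sub>m kron A B"
  by (intro eq_matI) (auto simp: kron_def div_mod_less_mult mult.left_commute)

lemma (in semiring_hom) map_kron:
  "map_mat hom (kron A B) = kron (map_mat hom A) (map_mat hom B)"
  by (intro eq_matI) (auto simp: kron_def div_mod_less_mult hom_mult)

lemma det_kron_one:
  fixes C :: "'a :: idom mat"
  assumes C: "C \<in> carrier_mat m m"
  shows "det (kron (1\<^sub>m n) C) = det C ^ n"
proof (induction n)
  case 0
  have "kron (1\<^sub>m 0) C = 1\<^sub>m 0" by (rule eq_matI) (auto simp: kron_def)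
  then show ?case by simp
next
  case (Suc n)
  then show ?case
    unfolding kron_one_Suc[OF C]
    by (subst det_four_block_mat_lower_left_zero[OF kron_carrier[OF one_carrier_mat C] _ refl C]) auto
qed

section \<open>Determinants\<close>

text \<open>Block column elimination: multiplying on the right by the unipotent matrix
  \<open>?L\<close> clears the lower left block and leaves the Schur complement in the upper left
  one.\<close>

lemma det_schur_complement:
  fixes A :: "'a :: idom mat"
  assumes A: "A \<in> carrier_mat n n" and B: "B \<in> carrier_mat n m"
    and C: "C \<in> carrier_mat m n" and D: "D \<in> carrier_mat m m"
    and E: "E \<in> carrier_mat m m" and DE: "D * E = 1\<^sub>m m"
  shows "det (four_block_mat A B C D) = det (A - B * E * C) * det D"
proof -
  let ?M = "four_block_mat A B C D"
  let ?L = "four_block_mat (1\<^sub>m n) (0\<^sub>m n m) (- (E * C)) (1\<^sub>m m)"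
  have EC: "E * C \<in> carrier_mat m n" using E C by auto
  \<comment> \<open>This is the lower left block of \<open>?M * ?L\<close>; it vanishes because
    \<open>D * E\<close> is the identity.\<close>
  have "C + D * - (E * C) = C - D * (E * C)"
    using C D E by (simp add: uminus_mult_right_mat[of D "E * C"] add_uminus_minus_mat[of _ m n])
  also have "D * (E * C) = C"
    using C D E DE by (simp add: assoc_mult_mat[symmetric])
  finally have zero: "C + D * - (E * C) = 0\<^sub>m m n"
    using C by auto
  have "A + B * - (E * C) = A - B * (E * C)"
    using A B C E by (simp add: uminus_mult_right_mat[of B "E * C"] add_uminus_minus_mat[of _ n n])
  then have AB: "A + B * - (E * C) = A - B * E * C"
    using A B C E by (simp add: assoc_mult_mat)
  have prod: "?M * ?L = four_block_mat (A - B * E * C) B (0\<^sub>m m n) D"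
  proof -
    have "A * 1\<^sub>m n + B * - (E * C) = A - B * E * C" "C * 1\<^sub>m n + D * - (E * C) = 0\<^sub>m m n"
      by (simp_all only: right_mult_one_mat[OF A] right_mult_one_mat[OF C] AB zero)
    moreover have "A * 0\<^sub>m n m + B * 1\<^sub>m m = B" "C * 0\<^sub>m n m + D * 1\<^sub>m m = D"
      using A B C D by simp_all
    moreover have "- (E * C) \<in> carrier_mat m n"
      using EC by simp
    ultimately show ?thesis
      by (simp only: mult_four_block_mat[OF A B C D one_carrier_mat zero_carrier_mat _ one_carrier_mat])
  qed
  have "det ?M * det ?L = det (?M * ?L)"
    by (rule det_mult[symmetric]) (use A D EC in auto)
  also have "\<dots> = det (A - B * E * C) * det D"
    unfolding prod by (rule det_four_block_mat_lower_left_zero) (use A B C D E in auto)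
  also have "det ?L = 1"
    by (subst det_four_block_mat_upper_right_zero[where n = n and m = m]) (use EC in auto)
  finally show ?thesis by simp
qed

text \<open>Rows and columns each contribute the sign of \<open>p\<close>, and the two signs cancel.
  Transposition reduces the column permutation to a row permutation.\<close>

lemma det_permute_rows_cols:
  fixes A :: "'a :: comm_ring_1 mat"
  assumes A: "A \<in> carrier_mat n n" and p: "p permutes {..<n}"
  shows "det (mat n n (\<lambda>(i, j). A $$ (p i, p j))) = det A"
proof -
  have p': "p permutes {0..<n}" using p by (simp add: atLeast0LessThan)
  have lt: "p i < n" if "i < n" for i using permutes_in_image[OF p'] that by auto
  let ?B = "mat n n (\<lambda>(i, j). A $$ (p i, j))"
  have "det (mat n n (\<lambda>(i, j). A $$ (p i, p j)))
      = det (mat n n (\<lambda>(i, j). A $$ (p i, p j)))\<^sup>T"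
    by (rule det_transpose[symmetric]) auto
  also have "(mat n n (\<lambda>(i, j). A $$ (p i, p j)))\<^sup>T = mat n n (\<lambda>(i, j). ?B\<^sup>T $$ (p i, j))"
    by (rule eq_matI) (auto simp: lt)
  also have "det \<dots> = signof p * det ?B\<^sup>T"
    by (rule det_permute_rows[OF _ p']) auto
  also have "det ?B\<^sup>T = det ?B"
    by (rule det_transpose) auto
  also have "det ?B = signof p * det A"
    by (rule det_permute_rows[OF A p'])
  finally show ?thesis
    by (simp add: sign_def)
qed

text \<open>Changing the enumeration permutes rows and columns simultaneously. This permits
  computing with one convenient vertex order of the corona.\<close>

lemma char_poly_adj_matrix_enum:
  assumes "distinct vs" "distinct ws" "set vs = set ws"
  shows "char_poly (adj_matrix vs G) = char_poly (adj_matrix ws G)"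
proof -
  have "mset vs = mset ws"
    using assms by (simp add: set_eq_iff_mset_eq_distinct)
  then obtain p where p: "p permutes {..<length ws}" and vs: "permute_list p ws = vs"
    by (rule mset_eq_permutation)
  let ?n = "length ws" and ?M = "char_poly_matrix (adj_matrix ws G)"
  have len: "length vs = ?n" using vs by auto
  have lt: "p i < ?n" if "i < ?n" for i using permutes_in_image[OF p] that by auto
  \<comment> \<open>Injectivity keeps diagonal entries on the diagonal, so the part
    \<open>x I\<close> of the characteristic matrix is preserved.\<close>
  have eq: "p i = p j \<longleftrightarrow> i = j" for i j using permutes_inj[OF p] by (auto dest: injD)
  have "char_poly_matrix (adj_matrix vs G) = mat ?n ?n (\<lambda>(i, j). ?M $$ (p i, p j))"
    by (rule eq_matI)
      (auto simp: char_poly_matrix_def adj_matrix_def len lt eq permute_list_nth[OF p] simp flip: vs)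
  moreover have "?M \<in> carrier_mat ?n ?n"
    by (rule char_poly_matrix_closed) (simp add: adj_matrix_def)
  ultimately show ?thesis
    unfolding char_poly_def using det_permute_rows_cols[OF _ p] by simp
qed

section \<open>Real symmetric matrices\<close>

text \<open>Evaluating the Hermitian form of \<open>A\<close> at an eigenvector \<open>v\<close> in
  two ways gives both \<open>k\<close> and its conjugate times the squared norm of \<open>v\<close>,
  which is nonzero.\<close>

lemma real_symmetric_eigenvalue:
  fixes A :: "real mat"
  assumes A: "A \<in> carrier_mat n n" and sym: "A\<^sup>T = A"
    and ev: "eigenvalue (map_mat complex_of_real A) k"
  shows "k \<in> \<real>"
proof -
  let ?A = "map_mat complex_of_real A"
  have cA: "?A \<in> carrier_mat n n" using A by simp
  obtain v where v: "v \<in> carrier_vec n" "v \<noteq> 0\<^sub>v n" and Av: "?A *\<^sub>v v = k \<cdot>\<^sub>v v"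
    using ev cA by (auto simp: eigenvalue_def eigenvector_def)
  have cv: "conjugate v \<in> carrier_vec n" using v by simp
  have ct: "?A\<^sup>T = ?A" using sym by (metis map_mat_transpose)
  \<comment> \<open>The entries of \<open>?A\<close> are real, so conjugation passes through the
    product.\<close>
  have "?A *\<^sub>v conjugate v = conjugate (?A *\<^sub>v v)"
    using cA v A by (intro eq_vecI) (auto simp: scalar_prod_def)
  then have Acv: "?A *\<^sub>v conjugate v = conjugate k \<cdot>\<^sub>v conjugate v"
    unfolding Av by (simp add: conjugate_smult_vec)
  have "k * (v \<bullet>c v) = (?A *\<^sub>v v) \<bullet>c v"
    unfolding Av using v by simp
  \<comment> \<open>Symmetry moves \<open>?A\<close> to the other factor of the bilinear
    product.\<close>
  also have "\<dots> = v \<bullet> (?A *\<^sub>v conjugate v)"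
    using transpose_vec_mult_scalar[OF cA cv v(1)] ct cv v cA
    by (metis comm_scalar_prod mult_mat_vec_carrier)
  also have "\<dots> = conjugate k * (v \<bullet>c v)"
    unfolding Acv using v by simp
  finally have "k = cnj k"
    using conjugate_square_eq_0_vec[OF v(1)] v(2) by simp
  then show ?thesis
    by (simp add: Reals_cnj_iff)
qed

text \<open>Over the complex numbers the polynomial splits, and all its roots are real. The
  factorisation descends because the embedding of real polynomials is injective.\<close>

lemma real_symmetric_char_poly_splits:
  fixes A :: "real mat"
  assumes A: "A \<in> carrier_mat n n" and sym: "A\<^sup>T = A"
  obtains es where "char_poly A = (\<Prod>e\<leftarrow>es. [:- e, 1:])" "length es = n"
proof -
  interpret P: map_poly_inj_idom_hom complex_of_real ..
  let ?A = "map_mat complex_of_real A"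
  have cA: "?A \<in> carrier_mat n n" using A by simp
  obtain as where as: "char_poly ?A = (\<Prod>a\<leftarrow>as. [:- a, 1:])" and len: "length as = n"
    using char_poly_factorized[OF cA] by blast
  have "a \<in> \<real>" if "a \<in> set as" for a
  proof (rule real_symmetric_eigenvalue[OF A sym])
    have "poly (char_poly ?A) a = 0"
      unfolding as poly_prod_list using that by (auto simp: prod_list_zero_iff image_iff)
    then show "eigenvalue ?A a"
      using eigenvalue_root_char_poly[OF cA] by simp
  qed
  then have real: "map complex_of_real (map Re as) = as"
    by (auto intro!: nth_equalityI simp: complex_is_Real_iff complex_eq_iff)
  have "map_poly complex_of_real (char_poly A) = char_poly ?A"
    by (rule of_real_hom.char_poly_hom[OF A, symmetric])
  also have "\<dots> = (\<Prod>a\<leftarrow>map complex_of_real (map Re as). [:- a, 1:])"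
    unfolding real by (rule as)
  also have "\<dots> = map_poly complex_of_real (\<Prod>e\<leftarrow>map Re as. [:- e, 1:])"
    by (simp add: P.hom_prod_list o_def)
  finally have "char_poly A = (\<Prod>e\<leftarrow>map Re as. [:- e, 1:])"
    by (rule P.injectivity)
  then show ?thesis using that[of "map Re as"] len by simp
qed


section \<open>Determinants of quadratic expressions in a matrix\<close>

definition quadratic_mat :: "'a :: comm_ring_1 \<Rightarrow> 'a \<Rightarrow> 'a mat \<Rightarrow> 'a mat" where
  "quadratic_mat x g A = x \<cdot>\<^sub>m 1\<^sub>m (dim_row A) - A - g \<cdot>\<^sub>m (A * A)"

text \<open>Conjugation fixes scalar matrices and respects sums and squares. Hence the Schur
  complement, which has the form \<open>quadratic_mat\<close>, can be evaluated on a triangular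
  matrix.\<close>

lemma similar_quadratic_mat:
  assumes "similar_mat A B"
  shows "similar_mat (quadratic_mat x g A) (quadratic_mat x g B)"
proof -
  obtain n P Q where carr: "{A, B, P, Q} \<subseteq> carrier_mat n n"
    and PQ: "P * Q = 1\<^sub>m n" and QP: "Q * P = 1\<^sub>m n" and AB: "A = P * B * Q"
    using similar_matD[OF assms] by blast
  have A: "A \<in> carrier_mat n n" and B: "B \<in> carrier_mat n n"
    and P: "P \<in> carrier_mat n n" and Q: "Q \<in> carrier_mat n n"
    using carr by auto
  have BB: "B * B \<in> carrier_mat n n" using B by simp
  have AA: "A * A = P * (B * B) * Q"
  proof -
    have "A * A = P * B * (Q * P) * B * Q"
      unfolding AB using B P Q by (simp add: assoc_mult_mat[of _ n n _ n _ n])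
    then show ?thesis
      unfolding QP using B P Q by (simp add: assoc_mult_mat[of _ n n _ n _ n])
  qed
  have x1: "P * (x \<cdot>\<^sub>m 1\<^sub>m n) * Q = x \<cdot>\<^sub>m 1\<^sub>m n"
    using P Q PQ by (simp add: mult_smult_distrib[OF P one_carrier_mat] mult_smult_assoc_mat[OF P Q])
  have gBB: "P * (g \<cdot>\<^sub>m (B * B)) * Q = g \<cdot>\<^sub>m (A * A)"
    unfolding AA using P Q BB
    by (simp add: mult_smult_distrib[OF P BB] mult_smult_assoc_mat[of _ n n _ n])
  let ?X = "x \<cdot>\<^sub>m 1\<^sub>m n" and ?Y = "g \<cdot>\<^sub>m (B * B)"
  have X: "?X \<in> carrier_mat n n" and Y: "?Y \<in> carrier_mat n n" using BB by auto
  have XB: "?X - B \<in> carrier_mat n n" using X B by auto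
  have PX: "P * ?X \<in> carrier_mat n n" and PB: "P * B \<in> carrier_mat n n"
    and PY: "P * ?Y \<in> carrier_mat n n"
    using P X B Y by (auto intro: mult_carrier_mat)
  have "P * (?X - B - ?Y) * Q = P * ?X * Q - P * B * Q - P * ?Y * Q"
    unfolding mult_minus_distrib_mat[OF P XB Y] mult_minus_distrib_mat[OF P X B]
    using minus_mult_distrib_mat[OF _ PY Q, of "P * ?X - P * B"] minus_mult_distrib_mat[OF PX PB Q] PB
    by (simp only: minus_carrier_mat)
  then have "quadratic_mat x g A = P * quadratic_mat x g B * Q"
    unfolding quadratic_mat_def carrier_matD(1)[OF A] carrier_matD(1)[OF B] x1 gBB AB[symmetric] ..
  moreover have "quadratic_mat x g A \<in> carrier_mat n n" "quadratic_mat x g B \<in> carrier_mat n n"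
    using A B by (auto simp: quadratic_mat_def)
  ultimately show ?thesis
    using P Q PQ QP by (intro similar_matI[of _ _ P Q n]) auto
qed

text \<open>The square of an upper triangular matrix is upper triangular with squared diagonal, so
  the whole expression is triangular and its determinant is read off the diagonal.\<close>

lemma det_quadratic_mat_upper_triangular:
  assumes B: "B \<in> carrier_mat n n" and ut: "upper_triangular B"
  shows "det (quadratic_mat x g B) = (\<Prod>e\<leftarrow>diag_mat B. x - e - g * e\<^sup>2)"
proof -
  have Q: "quadratic_mat x g B \<in> carrier_mat n n"
    using B by (auto simp: quadratic_mat_def)
  have zero: "B $$ (i, j) = 0" if "j < i" "i < n" for i j
    using upper_triangularD[OF ut] that B by auto
  have BB: "(B * B) $$ (i, j) = (if i = j then (B $$ (i, i))\<^sup>2 else 0)" if "j \<le> i" "i < n" for i j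
  proof -
    have "(B * B) $$ (i, j) = (\<Sum>k<n. B $$ (i, k) * B $$ (k, j))"
      using that by (intro index_mult_mat_sum[OF B B]) auto
    \<comment> \<open>For \<open>k < i\<close> the first factor lies below the diagonal; for
      \<open>k > i\<close> the second does, as \<open>j \<le> i\<close>. Only \<open>k = i\<close>
      survives.\<close>
    also have "\<dots> = (\<Sum>k<n. if k = i then B $$ (i, i) * B $$ (i, j) else 0)"
    proof (rule sum.cong[OF refl])
      fix k assume k: "k \<in> {..<n}"
      show "B $$ (i, k) * B $$ (k, j) = (if k = i then B $$ (i, i) * B $$ (i, j) else 0)"
        using zero[of k i] zero[of j k] k that by (cases k i rule: linorder_cases) auto
    qed
    also have "\<dots> = B $$ (i, i) * B $$ (i, j)"
      using that by simp
    finally show ?thesis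
      using zero[of j i] that by (auto simp: power2_eq_square)
  qed
  have idx: "quadratic_mat x g B $$ (i, j)
      = (if i = j then x - B $$ (i, i) - g * (B $$ (i, i))\<^sup>2 else 0)" if "j \<le> i" "i < n" for i j
  proof -
    have "quadratic_mat x g B $$ (i, j)
        = (if i = j then x else 0) - B $$ (i, j) - g * (B * B) $$ (i, j)"
      using that B by (simp add: quadratic_mat_def)
    then show ?thesis
      unfolding BB[OF that] using zero[of j i] that by auto
  qed
  have "upper_triangular (quadratic_mat x g B)"
    using Q idx by (intro upper_triangularI) auto
  then have "det (quadratic_mat x g B) = prod_list (diag_mat (quadratic_mat x g B))"
    using Q by (rule det_upper_triangular)
  also have "diag_mat (quadratic_mat x g B) = map (\<lambda>e. x - e - g * e\<^sup>2) (diag_mat B)"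
    using Q B idx by (auto simp: diag_mat_def intro!: nth_equalityI)
  finally show ?thesis .
qed

text \<open>Triangularisation takes place over the base field, where the eigenvalues lie, and is
  then carried along \<open>h\<close>. The coefficients \<open>x\<close> and \<open>g\<close> live
  in the target ring, here the rational functions.\<close>

lemma det_quadratic_mat_hom:
  fixes h :: "'a :: conjugatable_ordered_field \<Rightarrow> 'b :: comm_ring_1"
  assumes h: "comm_ring_hom h" and A: "A \<in> carrier_mat n n"
    and es: "char_poly A = (\<Prod>e\<leftarrow>es. [:- e, 1:])"
  shows "det (quadratic_mat x g (map_mat h A)) = (\<Prod>e\<leftarrow>es. x - h e - g * (h e)\<^sup>2)"
proof -
  interpret comm_ring_hom h by (rule h)
  \<comment> \<open>The Schur form places the given roots \<open>es\<close> on the diagonal of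
    \<open>B\<close>.\<close>
  obtain B P Q where BPQ: "schur_decomposition A es = (B, P, Q)"
    by (metis prod_cases3)
  from schur_decomposition[OF A es BPQ] have sim: "similar_mat A B"
    and ut: "upper_triangular B" and diag: "diag_mat B = es"
    by (auto simp: similar_mat_def)
  obtain m P Q where PQ': "{A, B, P, Q} \<subseteq> carrier_mat m m" "P * Q = 1\<^sub>m m" "Q * P = 1\<^sub>m m"
    and AB: "A = P * B * Q"
    using similar_matD[OF sim] by blast
  have "m = n"
    using PQ'(1) A carrier_matD(1)[of A] by (metis insert_subset)
  note PQ = PQ'[unfolded this]
  then have B: "B \<in> carrier_mat n n" and P: "P \<in> carrier_mat n n" and Q: "Q \<in> carrier_mat n n"
    by auto
  have "map_mat h A = map_mat h P * map_mat h B * map_mat h Q"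
    unfolding AB using B P Q by (simp add: mat_hom_mult[of _ n n _ n])
  moreover have "map_mat h P * map_mat h Q = 1\<^sub>m n" "map_mat h Q * map_mat h P = 1\<^sub>m n"
    using PQ mat_hom_mult[OF P Q] mat_hom_mult[OF Q P] by (simp_all add: mat_hom_one)
  ultimately have "similar_mat (map_mat h A) (map_mat h B)"
    using PQ by (intro similar_matI[of _ _ "map_mat h P" "map_mat h Q" n]) auto
  then have "det (quadratic_mat x g (map_mat h A)) = det (quadratic_mat x g (map_mat h B))"
    by (intro det_similar similar_quadratic_mat)
  also have "\<dots> = (\<Prod>e\<leftarrow>diag_mat (map_mat h B). x - e - g * e\<^sup>2)"
    using B ut by (intro det_quadratic_mat_upper_triangular[of _ n]) (auto simp: upper_triangular_def)
  also have "diag_mat (map_mat h B) = map h es"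
    using B diag by (auto simp: diag_mat_def intro!: nth_equalityI)
  finally show ?thesis by (simp add: o_def)
qed

text \<open>The roots in \<open>es\<close> come in arbitrary order, whereas
  \<open>nth_eigenvalue\<close> numbers them decreasingly; a commutative product depends only on the
  multiset.\<close>

lemma prod_nth_eigenvalue:
  fixes f :: "real \<Rightarrow> 'a :: comm_monoid_mult"
  assumes "char_poly A = (\<Prod>e\<leftarrow>es. [:- e, 1:])"
  shows "(\<Prod>i = 1..length es. f (nth_eigenvalue A i)) = (\<Prod>e\<leftarrow>es. f e)"
proof -
  have "proots (char_poly A) = mset es"
    unfolding assms by (induction es) (simp_all add: proots_mult prod_list_zero_iff image_iff del: mult_pCons_left)
  then have ev: "nth_eigenvalue A i = rev (sort es) ! (i - 1)" for i
    by (simp add: nth_eigenvalue_def sorted_list_of_multiset_mset)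
  \<comment> \<open>Eigenvalues are counted from 1 but list positions from 0.\<close>
  have "(\<Prod>i = 1..length es. f (nth_eigenvalue A i)) = (\<Prod>i<length es. f (rev (sort es) ! i))"
    unfolding ev by (rule prod.reindex_bij_witness[of _ Suc "\<lambda>i. i - 1"]) auto
  also have "\<dots> = prod_list (map f (rev (sort es)))"
    by (simp add: prod.list_conv_set_nth atLeast0LessThan)
  also have "\<dots> = prod_mset (mset (map f (rev (sort es))))"
    by (rule prod_mset_prod_list[symmetric])
  also have "mset (map f (rev (sort es))) = mset (map f es)"
    by simp
  finally show ?thesis
    by (simp only: prod_mset_prod_list)
qed

section \<open>The neighbourhood corona\<close>

abbreviation const_fract :: "'a :: idom \<Rightarrow> 'a poly fract" where
  "const_fract a \<equiv> to_fract [:a:]"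

lemma to_fract_hom: "comm_ring_hom (to_fract :: 'a :: idom \<Rightarrow> 'a fract)"
  by standard auto

lemma const_fract_hom: "comm_ring_hom (const_fract :: 'a :: idom \<Rightarrow> 'a poly fract)"
  by standard (auto simp flip: to_fract_add to_fract_mult simp: one_pCons[symmetric])

lemma to_fract_char_poly_matrix:
  assumes "A \<in> carrier_mat n n"
  shows "map_mat to_fract (char_poly_matrix A)
    = to_fract [:0, 1:] \<cdot>\<^sub>m 1\<^sub>m n - map_mat const_fract A"
  using assms
  by (intro eq_matI) (auto simp: char_poly_matrix_def simp flip: to_fract_diff to_fract_uminus)

text \<open>The row \<open>J\<close> of the overview, as a matrix so that it can be a Kronecker
  factor.\<close>

definition ones_row :: "nat \<Rightarrow> 'a :: one mat" where
  "ones_row m = mat 1 m (\<lambda>_. 1)"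

lemma ones_row_carrier [simp]: "ones_row m \<in> carrier_mat 1 m"
  by (simp add: ones_row_def)

lemma ones_row_transpose_carrier [simp]: "(ones_row m)\<^sup>T \<in> carrier_mat m 1"
  by (simp add: ones_row_def)

lemma (in semiring_hom) map_ones_row:
  "map_mat hom (ones_row m) = ones_row m" "map_mat hom (ones_row m)\<^sup>T = (ones_row m)\<^sup>T"
  by (auto simp: ones_row_def)

text \<open>The characteristic polynomial is monic, so its image in the fraction field is nonzero
  and \<open>mat_inverse\<close> succeeds. Sandwiching the inverse between all-ones vectors gives
  the coronal as a 1-by-1 matrix.\<close>

lemma coronal_inverse:
  assumes A: "A \<in> carrier_mat m m"
  obtains E where "E \<in> carrier_mat m m"
    and "map_mat to_fract (char_poly_matrix A) * E = 1\<^sub>m m"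
    and "ones_row m * E * (ones_row m)\<^sup>T = coronal A \<cdot>\<^sub>m 1\<^sub>m 1"
proof -
  interpret comm_ring_hom "to_fract :: real poly \<Rightarrow> real poly fract" by (rule to_fract_hom)
  let ?C = "map_mat to_fract (char_poly_matrix A)"
  have C: "?C \<in> carrier_mat m m" using A by simp
  have "char_poly A \<noteq> 0"
    using degree_monic_char_poly[OF A] by auto
  then have "det ?C \<noteq> 0"
    by (simp add: char_poly_def)
  then have "?C \<in> Units (ring_mat TYPE(real poly fract) m ())"
    by (rule det_non_zero_imp_unit[OF C])
  then obtain E where inv: "mat_inverse ?C = Some E"
    using mat_inverse(1)[OF C, of "()"] by (cases "mat_inverse ?C") blast+
  note E = mat_inverse(2)[OF C inv]
  let ?one = "vec m (\<lambda>_. 1) :: real poly fract vec"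
  have cor: "coronal A = ?one \<bullet> (E *\<^sub>v ?one)"
    using A inv by (simp add: coronal_def Let_def)
  have "ones_row m * E * (ones_row m)\<^sup>T = ones_row m * (E * (ones_row m)\<^sup>T)"
    using E by (intro assoc_mult_mat[OF ones_row_carrier _ ones_row_transpose_carrier]) simp
  also have "\<dots> = coronal A \<cdot>\<^sub>m 1\<^sub>m 1"
    unfolding cor using E
    by (intro eq_matI) (auto simp: ones_row_def scalar_prod_def intro!: sum.cong)
  finally show ?thesis
    using E that by blast
qed

lemma kron_one_right:
  assumes "A \<in> carrier_mat a b"
  shows "kron A (1\<^sub>m 1) = A"
  using assms by (intro eq_matI) (auto simp: kron_def)

lemma scalar_minus_four_block:
  fixes A :: "'a :: comm_ring_1 mat"
  assumes "A \<in> carrier_mat n n" "B \<in> carrier_mat n m" "C \<in> carrier_mat m n" "D \<in> carrier_mat m m"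
  shows "x \<cdot>\<^sub>m 1\<^sub>m (n + m) - four_block_mat A B C D
    = four_block_mat (x \<cdot>\<^sub>m 1\<^sub>m n - A) (- B) (- C) (x \<cdot>\<^sub>m 1\<^sub>m m - D)"
  using assms by (intro eq_matI) auto

text \<open>The Schur complement is taken with respect to \<open>kron (1\<^sub>m n) C\<close>, whose
  inverse \<open>kron (1\<^sub>m n) E\<close> comes from the mixed-product rule.\<close>

lemma det_corona_block:
  fixes A :: "'a :: idom mat"
  assumes A: "A \<in> carrier_mat n n" and C: "C \<in> carrier_mat m m" and E: "E \<in> carrier_mat m m"
    and CE: "C * E = 1\<^sub>m m" and g: "ones_row m * E * (ones_row m)\<^sup>T = g \<cdot>\<^sub>m 1\<^sub>m 1"
  shows "det (four_block_mat (x \<cdot>\<^sub>m 1\<^sub>m n - A) (- kron A (ones_row m)) (- kron A (ones_row m)\<^sup>T)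
      (kron (1\<^sub>m n) C)) = det (quadratic_mat x g A) * det C ^ n"
proof -
  let ?B = "kron A (ones_row m)" and ?B' = "kron A (ones_row m)\<^sup>T"
  let ?D = "kron (1\<^sub>m n) C" and ?E = "kron (1\<^sub>m n) E"
  have B: "?B \<in> carrier_mat n (n * m)" and B': "?B' \<in> carrier_mat (n * m) n"
    and D: "?D \<in> carrier_mat (n * m) (n * m)" and E': "?E \<in> carrier_mat (n * m) (n * m)"
    using kron_carrier[OF A ones_row_carrier] kron_carrier[OF A ones_row_transpose_carrier]
      kron_carrier[OF one_carrier_mat C] kron_carrier[OF one_carrier_mat E]
    by simp_all
  have DE: "?D * ?E = 1\<^sub>m (n * m)"
    by (simp add: kron_mult[OF one_carrier_mat C one_carrier_mat E] CE kron_one_one)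
  have JE: "ones_row m * E \<in> carrier_mat 1 m"
    by (rule mult_carrier_mat[OF ones_row_carrier E])
  have BE: "?B * ?E = kron A (ones_row m * E)"
    using A by (simp add: kron_mult[OF A ones_row_carrier one_carrier_mat E])
  \<comment> \<open>The two signs cancel, and the mixed-product rule collapses the second Kronecker
    factor to the 1-by-1 matrix with entry \<open>g\<close>.\<close>
  have "- ?B * ?E * - ?B' = ?B * ?E * ?B'"
    using carrier_matD[OF B] carrier_matD[OF B'] carrier_matD[OF E']
    by (simp only: uminus_mult_left_mat uminus_mult_right_mat index_mult_mat index_uminus_mat
        uminus_uminus_mat)
  also have "\<dots> = kron (A * A) (ones_row m * E * (ones_row m)\<^sup>T)"
    unfolding BE by (rule kron_mult[OF A JE A ones_row_transpose_carrier])
  also have "\<dots> = g \<cdot>\<^sub>m (A * A)"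
    unfolding g kron_smult kron_one_right[OF mult_carrier_mat[OF A A]] ..
  finally have "- ?B * ?E * - ?B' = g \<cdot>\<^sub>m (A * A)" .
  then have "x \<cdot>\<^sub>m 1\<^sub>m n - A - - ?B * ?E * - ?B' = quadratic_mat x g A"
    using A by (simp add: quadratic_mat_def)
  moreover have "det (four_block_mat (x \<cdot>\<^sub>m 1\<^sub>m n - A) (- ?B) (- ?B') ?D)
      = det (x \<cdot>\<^sub>m 1\<^sub>m n - A - - ?B * ?E * - ?B') * det ?D"
    by (rule det_schur_complement[OF minus_carrier_mat[OF A] uminus_carrier_mat[OF B]
        uminus_carrier_mat[OF B'] D E' DE])
  ultimately show ?thesis
    by (simp add: det_kron_one[OF C])
qed

section \<open>Vertex order and block form of the corona\<close>

definition corona_enum :: "'a list \<Rightarrow> 'b list \<Rightarrow> ('a + 'a \<times> 'b) list" where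
  "corona_enum vs ws = map Inl vs @ map Inr (List.product vs ws)"

lemma distinct_corona_enum:
  "distinct vs \<Longrightarrow> distinct ws \<Longrightarrow> distinct (corona_enum vs ws)"
  by (auto simp: corona_enum_def distinct_map distinct_product)

lemma set_corona_enum:
  "set (corona_enum vs ws) = Inl ` set vs \<union> Inr ` (set vs \<times> set ws)"
  by (auto simp: corona_enum_def)

lemma length_corona_enum [simp]:
  "length (corona_enum vs ws) = length vs + length vs * length ws"
  by (simp add: corona_enum_def)

lemma corona_enum_nth:
  "i < length vs \<Longrightarrow> corona_enum vs ws ! i = Inl (vs ! i)"
  "\<not> i < length vs \<Longrightarrow> i < length vs + length vs * length ws \<Longrightarrow> corona_enum vs ws ! i =
     Inr (vs ! ((i - length vs) div length ws), ws ! ((i - length vs) mod length ws))"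
  by (auto simp: corona_enum_def nth_append product_nth)

lemma nbhd_corona_arcs [simp]:
  "(Inl v, Inl w) \<in> parcs (nbhd_corona G H) \<longleftrightarrow> (v, w) \<in> parcs G"
  "(Inr (v, u), Inr (w, u')) \<in> parcs (nbhd_corona G H) \<longleftrightarrow>
    v = w \<and> v \<in> pverts G \<and> (u, u') \<in> parcs H"
  "(Inl w, Inr (v, u)) \<in> parcs (nbhd_corona G H) \<longleftrightarrow> (v, w) \<in> parcs G \<and> u \<in> pverts H"
  "(Inr (v, u), Inl w) \<in> parcs (nbhd_corona G H) \<longleftrightarrow> (v, w) \<in> parcs G \<and> u \<in> pverts H"
  by (auto simp: nbhd_corona_def)

lemma adj_matrix_carrier: "adj_matrix vs G \<in> carrier_mat (length vs) (length vs)"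
  by (simp add: adj_matrix_def)

lemma pair_graph_arc_sym:
  assumes "pair_graph G"
  shows "(u, v) \<in> parcs G \<longleftrightarrow> (v, u) \<in> parcs G"
proof -
  interpret pair_graph G by fact
  show ?thesis
    using pair_sym_arcs by (auto simp: symmetric_def dest: symD)
qed

text \<open>Each block records one kind of arc. Cross arcs depend only on the copy and not on the
  vertex in it, hence the factor \<open>ones_row m\<close>; distinct copies are not joined, hence
  \<open>1\<^sub>m n\<close>.\<close>

lemma adj_matrix_corona_enum:
  assumes G: "pair_graph G" and vs: "distinct vs" "set vs = pverts G" and ws: "set ws = pverts H"
  defines "n \<equiv> length vs" and "m \<equiv> length ws"
  shows "adj_matrix (corona_enum vs ws) (nbhd_corona G H) =
    four_block_mat (adj_matrix vs G) (kron (adj_matrix vs G) (ones_row m))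
      (kron (adj_matrix vs G) (ones_row m)\<^sup>T) (kron (1\<^sub>m n) (adj_matrix ws H))"
    (is "?L = ?R")
proof (rule eq_matI)
  show "dim_row ?L = dim_row ?R" "dim_col ?L = dim_col ?R"
    by (auto simp: adj_matrix_def kron_def n_def m_def)
  fix i j
  assume "i < dim_row ?R" "j < dim_col ?R"
  then have i: "i < n + n * m" and j: "j < n + n * m"
    by (auto simp: adj_matrix_def kron_def n_def m_def)
  have vs_mem: "vs ! k \<in> pverts G" if "k < n" for k
    using that vs nth_mem[of k vs] by (simp add: n_def)
  have ws_mem: "ws ! k \<in> pverts H" if "k < m" for k
    using that ws nth_mem[of k ws] by (simp add: m_def)
  have vs_eq: "vs ! k = vs ! l \<longleftrightarrow> k = l" if "k < n" "l < n" for k l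
    using that vs by (simp add: n_def nth_eq_iff_index_eq)
  have lt: "k - n < n * m" if "\<not> k < n" "k < n + n * m" for k
    using that by auto
  note dm = div_mod_less_mult[OF lt]
  have enum: "corona_enum vs ws ! k = (if k < n then Inl (vs ! k)
      else Inr (vs ! ((k - n) div m), ws ! ((k - n) mod m)))" if "k < n + n * m" for k
    using that corona_enum_nth[of k vs ws] by (simp add: n_def m_def)
  \<comment> \<open>In the upper right block the corona tests the arc \<open>(v, w)\<close> and
    \<open>adj_matrix vs G\<close> the reverse arc \<open>(w, v)\<close>; they agree by symmetry of
    \<open>G\<close>.\<close>
  show "?L $$ (i, j) = ?R $$ (i, j)"
    using i j dm[of i] dm[of j] lt[of i] lt[of j]
    by (cases "i < n"; cases "j < n")
      (auto simp: adj_matrix_def kron_def ones_row_def n_def[symmetric] m_def[symmetric]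
        enum vs_mem ws_mem vs_eq pair_graph_arc_sym[OF G])
qed

lemma to_fract_char_poly_corona:
  assumes G: "pair_graph G" and vs: "distinct vs" "set vs = pverts G" and ws: "set ws = pverts H"
  defines "n \<equiv> length vs"
  shows "to_fract (char_poly (adj_matrix (corona_enum vs ws) (nbhd_corona G H))) =
    det (quadratic_mat (to_fract [:0, 1:]) (coronal (adj_matrix ws H))
      (map_mat const_fract (adj_matrix vs G))) * to_fract (char_poly (adj_matrix ws H)) ^ n"
proof -
  interpret comm_ring_hom "to_fract :: real poly \<Rightarrow> real poly fract" by (rule to_fract_hom)
  let ?m = "length ws" and ?x = "to_fract [:0, 1:] :: real poly fract"
  let ?A = "adj_matrix vs G" and ?D = "adj_matrix ws H"
  let ?K = "adj_matrix (corona_enum vs ws) (nbhd_corona G H)"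
  let ?C = "map_mat to_fract (char_poly_matrix ?D)"
  have A: "?A \<in> carrier_mat n n" and D: "?D \<in> carrier_mat ?m ?m"
    and K: "?K \<in> carrier_mat (n + n * ?m) (n + n * ?m)"
    using adj_matrix_carrier[of vs G] adj_matrix_carrier[of ws H]
      adj_matrix_carrier[of "corona_enum vs ws"]
    by (auto simp: n_def)
  have C: "?C \<in> carrier_mat ?m ?m" using D by simp
  let ?h = "const_fract :: real \<Rightarrow> real poly fract"
  obtain E where E: "E \<in> carrier_mat ?m ?m" "?C * E = 1\<^sub>m ?m"
    and g: "ones_row ?m * E * (ones_row ?m)\<^sup>T = coronal ?D \<cdot>\<^sub>m 1\<^sub>m 1"
    using coronal_inverse[OF D] by blast
  interpret h: comm_ring_hom ?h by (rule const_fract_hom)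
  have hA: "map_mat ?h ?A \<in> carrier_mat n n" and hD': "map_mat ?h ?D \<in> carrier_mat ?m ?m"
    using A D by auto
  \<comment> \<open>The factor \<open>ones_row\<close> contributes a dimension 1;
    \<open>n * 1\<close> is normalised to \<open>n\<close> to fit the block rules.\<close>
  note B = kron_carrier[OF A ones_row_carrier[of ?m], unfolded mult_1_right]
    and B' = kron_carrier[OF A ones_row_transpose_carrier[of ?m], unfolded mult_1_right]
    and kD = kron_carrier[OF one_carrier_mat[of n] D]
    and hB = kron_carrier[OF hA ones_row_carrier[of ?m], unfolded mult_1_right]
    and hB' = kron_carrier[OF hA ones_row_transpose_carrier[of ?m], unfolded mult_1_right]
    and hD = kron_carrier[OF one_carrier_mat[of n] hD']
  let ?R = "four_block_mat (?x \<cdot>\<^sub>m 1\<^sub>m n - map_mat ?h ?A)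
      (- kron (map_mat ?h ?A) (ones_row ?m)) (- kron (map_mat ?h ?A) (ones_row ?m)\<^sup>T)
      (kron (1\<^sub>m n) ?C)"
  have "map_mat to_fract (char_poly_matrix ?K) = ?x \<cdot>\<^sub>m 1\<^sub>m (n + n * ?m) - map_mat ?h ?K"
    by (rule to_fract_char_poly_matrix[OF K])
  also have "map_mat ?h ?K = four_block_mat (map_mat ?h ?A) (kron (map_mat ?h ?A) (ones_row ?m))
      (kron (map_mat ?h ?A) (ones_row ?m)\<^sup>T) (kron (1\<^sub>m n) (map_mat ?h ?D))"
    unfolding adj_matrix_corona_enum[OF G vs ws] n_def[symmetric]
    by (subst map_four_block_mat[OF A B B' kD])
      (simp only: h.map_kron h.mat_hom_one h.map_ones_row)
  also have "?x \<cdot>\<^sub>m 1\<^sub>m (n + n * ?m) - \<dots> = ?R"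
  proof -
    \<comment> \<open>The lower right block of the characteristic matrix is itself a Kronecker
      product, since \<open>x I\<close> on all copies is \<open>kron\<close> of the identity with
      \<open>x I\<close> on one copy.\<close>
    have "kron (1\<^sub>m n) ?C = ?x \<cdot>\<^sub>m 1\<^sub>m (n * ?m) - kron (1\<^sub>m n) (map_mat ?h ?D)"
      unfolding to_fract_char_poly_matrix[OF D] kron_one_one[symmetric] kron_smult[symmetric]
      using D by (intro kron_minus) auto
    then show ?thesis
      using scalar_minus_four_block[OF hA hB hB' hD] by simp
  qed
  finally have "to_fract (char_poly ?K) = det ?R"
    by (simp add: char_poly_def flip: hom_det)
  also have "\<dots> = det (quadratic_mat ?x (coronal ?D) (map_mat ?h ?A)) * det ?C ^ n"
    using A by (intro det_corona_block[OF _ C E g]) simp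
  finally show ?thesis
    by (simp add: char_poly_def)
qed

theorem theorem2p1:
  fixes G1 :: "'a pair_pre_digraph" and G2 :: "'b pair_pre_digraph"
    and vs1 :: "'a list" and vs2 :: "'b list" and vs :: "('a + 'a \<times> 'b) list"
    and n1 n2 :: nat and A1 A2 A :: "real mat" and x :: "real poly fract"
  assumes "pair_graph G1" and "pair_graph G2"
    and "card (pverts G1) = n1" and "n1 \<ge> 1"
    and "card (pverts G2) = n2" and "n2 \<ge> 1"
    and "distinct vs1" and "set vs1 = pverts G1"
    and "distinct vs2" and "set vs2 = pverts G2"
    and "distinct vs" and "set vs = pverts (nbhd_corona G1 G2)"
  defines "A1 \<equiv> adj_matrix vs1 G1"
    and "A2 \<equiv> adj_matrix vs2 G2"
    and "A \<equiv> adj_matrix vs (nbhd_corona G1 G2)"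
    and "x \<equiv> to_fract [:0, 1:]"
  shows "to_fract (char_poly A) =
    to_fract (char_poly A2) ^ n1 *
    (\<Prod>i = 1..n1. x - to_fract [:nth_eigenvalue A1 i:]
       - coronal A2 * to_fract [:nth_eigenvalue A1 i:] ^ 2)"
proof -
  have n1: "length vs1 = n1"
    using assms(3,7,8) distinct_card by metis
  have A1: "A1 \<in> carrier_mat n1 n1"
    unfolding A1_def n1[symmetric] by (rule adj_matrix_carrier)
  have "A1\<^sup>T = A1"
    by (rule eq_matI) (auto simp: A1_def adj_matrix_def pair_graph_arc_sym[OF assms(1)])
  then obtain es where es: "char_poly A1 = (\<Prod>e\<leftarrow>es. [:- e, 1:])" and len: "length es = n1"
    using real_symmetric_char_poly_splits[OF A1] by metis
  \<comment> \<open>Both lists enumerate the vertices of the corona without repetition, so the given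
    order may be exchanged for the blockwise one.\<close>
  have "set vs = set (corona_enum vs1 vs2)"
    using assms(8,10,12) by (simp add: set_corona_enum nbhd_corona_def)
  then have "char_poly A = char_poly (adj_matrix (corona_enum vs1 vs2) (nbhd_corona G1 G2))"
    unfolding A_def using distinct_corona_enum assms(7,9,11) by (intro char_poly_adj_matrix_enum) auto
  then have "to_fract (char_poly A) =
      det (quadratic_mat x (coronal A2) (map_mat const_fract A1)) * to_fract (char_poly A2) ^ n1"
    using to_fract_char_poly_corona[OF assms(1,7,8,10)]
    by (simp add: A1_def A2_def x_def n1)
  also have "det (quadratic_mat x (coronal A2) (map_mat const_fract A1)) =
      (\<Prod>e\<leftarrow>es. x - const_fract e - coronal A2 * (const_fract e)\<^sup>2)"
    by (rule det_quadratic_mat_hom[OF const_fract_hom A1 es])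
  also have "\<dots> = (\<Prod>i = 1..n1. x - const_fract (nth_eigenvalue A1 i)
      - coronal A2 * (const_fract (nth_eigenvalue A1 i))\<^sup>2)"
    unfolding len[symmetric] by (rule prod_nth_eigenvalue[OF es, symmetric])
  finally show ?thesis by (simp only: mult.commute)
qed

end
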